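(* Let $S=\{s_1,\dots,s_n\}$, let $\mathcal{C}=\{C_1,\dots,C_k\}$ be linearly ordered by $\sigma$ with $C_1\prec_\sigma\dots\prec_\sigma C_k$, let $m\ge1$ and let $\mathcal{T}=\{(t_0,\dots,t_m): t_0,\dots,t_m:S\to\mathcal{C}\}$ be the set of all sequences of $m+1$ tests. Write $n=xk+y$ with integers $x\ge0$, $0\le y<k$. Then $$ecr(S,\mathcal{C},\mathcal{T},\sigma)=\tfrac{m}{2}\bigl(kx(n-x)+y(n-2x-1)\bigr),$$ and this maximum is achieved by a sequence of tests such that, writing $a_i(t_j)=|\{s: t_j(s)=C_i\}|$, at every test $k-y$ categories contain $x$ subjects and $y$ categories contain $x+1$ subjects, and $a_i(t_j)=a_{k-i+1}(t_{j+1})$ for all $i=1,\dots,k$ and $j=0,\dots,m-1$.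
   Context: For an ordinal panel data instance with tests $t_0,\dots,t_m:S\to\mathcal{C}$, a combinatorial layout is a sequence of linear orders $\pi_0,\dots,\pi_m$ of $S$ such that $t_j(s)\prec_\sigma t_j(s')$ implies $s$ precedes $s'$ in $\pi_j$. Its number of crossings is the number of pairs $(j,\{s,s'\})$, $0\le j\le m-1$, such that the relative order of $s,s'$ in $\pi_j$ differs from that in $\pi_{j+1}$. The panel crossing number $pcr(S,\mathcal{C},T,\sigma)$ is the minimum number of crossings over all combinatorial layouts, and $ecr(S,\mathcal{C},\mathcal{T},\sigma)=\max\{pcr(S,\mathcal{C},T,\sigma):T\in\mathcal{T}\}$. *)

theory Defs
  imports Complex_Main "HOL-Library.FuncSet"
begin

text \<open>
  Linear orders are reflexive relations (\<^const>\<open>linear_order_on\<close>), so the strict order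
  \<open>c \<prec>\<^sub>\<sigma> c'\<close> is \<open>(c, c') \<in> \<sigma> - Id\<close>. The category set is the field of \<open>\<sigma>\<close>
  and is therefore not a separate argument of the crossing numbers. A sequence \<open>t\<^sub>0, \<dots>, t\<^sub>m\<close> is
  a function on \<^typ>\<open>nat\<close> of which only the values at \<open>j \<le> m\<close> matter.
\<close>

definition test_sequences :: "nat \<Rightarrow> 's set \<Rightarrow> 'c set \<Rightarrow> (nat \<Rightarrow> 's \<Rightarrow> 'c) set" where
  "test_sequences m S Cs = {0..m} \<rightarrow>\<^sub>E (S \<rightarrow>\<^sub>E Cs)"

definition combinatorial_layout ::
  "nat \<Rightarrow> 's set \<Rightarrow> (nat \<Rightarrow> 's \<Rightarrow> 'c) \<Rightarrow> 'c rel \<Rightarrow> (nat \<Rightarrow> 's rel) \<Rightarrow> bool" where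
  "combinatorial_layout m S t \<sigma> \<pi> \<longleftrightarrow>
     (\<forall>j\<le>m. linear_order_on S (\<pi> j) \<and>
        (\<forall>s\<in>S. \<forall>s'\<in>S. (t j s, t j s') \<in> \<sigma> - Id \<longrightarrow> (s, s') \<in> \<pi> j - Id))"

definition crossings :: "nat \<Rightarrow> 's set \<Rightarrow> (nat \<Rightarrow> 's rel) \<Rightarrow> nat" where
  "crossings m S \<pi> =
     card {(j, {s, s'}) | j s s'. j < m \<and> s \<in> S \<and> s' \<in> S \<and> s \<noteq> s' \<and>
             ((s, s') \<in> \<pi> j) \<noteq> ((s, s') \<in> \<pi> (Suc j))}"

definition pcr :: "nat \<Rightarrow> 's set \<Rightarrow> (nat \<Rightarrow> 's \<Rightarrow> 'c) \<Rightarrow> 'c rel \<Rightarrow> nat" where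
  "pcr m S t \<sigma> = Min {crossings m S \<pi> | \<pi>. combinatorial_layout m S t \<sigma> \<pi>}"

definition ecr :: "nat \<Rightarrow> 's set \<Rightarrow> (nat \<Rightarrow> 's \<Rightarrow> 'c) set \<Rightarrow> 'c rel \<Rightarrow> nat" where
  "ecr m S \<T> \<sigma> = Max {pcr m S t \<sigma> | t. t \<in> \<T>}"

definition category_size :: "'s set \<Rightarrow> ('s \<Rightarrow> 'c) \<Rightarrow> 'c \<Rightarrow> nat" where
  "category_size S f c = card {s \<in> S. f s = c}"

end

theory Submission
  imports Defs
begin

text \<open>
  Call a pair of subjects separated by a test if the test puts them into different categories.
  Breaking the ties of \<open>\<pi>\<^sub>j\<close> by \<open>\<pi>\<^sub>j\<^sub>+\<^sub>1\<close>, from the last test backwards, yields a layout in which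
  only pairs separated by \<open>t\<^sub>j\<close> cross between \<open>j\<close> and \<open>j + 1\<close>. The number of separated pairs
  is maximal for a balanced test, because \<open>(a - x) (a - x - 1) \<ge> 0\<close> for every integer \<open>a\<close>, with
  equality exactly for \<open>a \<in> {x, x + 1}\<close>. Conversely, alternating a balanced test with its
  reversal forces all separated pairs to cross at every step.
\<close>

section \<open>Separated pairs\<close>

text \<open>Pairs are unordered, as in \<open>crossings\<close>, so that the crossings of one step
  can be compared with this set by inclusion.\<close>

definition separated_pairs :: "'s set \<Rightarrow> ('s \<Rightarrow> 'c) \<Rightarrow> 's set set" where
  "separated_pairs S f = {{s, s'} | s s'. s \<in> S \<and> s' \<in> S \<and> f s \<noteq> f s'}"

lemma finite_separated_pairs: "finite S \<Longrightarrow> finite (separated_pairs S f)"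
  by (rule finite_subset[of _ "Pow S"]) (auto simp: separated_pairs_def)

text \<open>Every fibre of the map to unordered pairs is {(a, b), (b, a)}, which has two elements by
  irreflexivity.\<close>

lemma card_sym_irrefl:
  assumes "finite R" "sym R" "irrefl R"
  shows "card R = 2 * card ((\<lambda>(a, b). {a, b}) ` R)"
proof -
  let ?h = "\<lambda>(a, b). {a, b}"
  have "card R = (\<Sum>e\<in>?h ` R. \<Sum>p\<in>{p \<in> R. ?h p = e}. 1)"
    using sum.image_gen[OF assms(1), of "\<lambda>_. 1::nat" ?h] by simp
  also have "\<dots> = (\<Sum>e\<in>?h ` R. 2)"
  proof (rule sum.cong[OF refl])
    fix e assume "e \<in> ?h ` R"
    then obtain a b where ab: "(a, b) \<in> R" "e = {a, b}" by auto
    then have "(b, a) \<in> R" "a \<noteq> b"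
      using assms(2,3) by (auto dest: symD simp: irrefl_def)
    then have "{p \<in> R. ?h p = e} = {(a, b), (b, a)}"
      using ab by (auto simp: doubleton_eq_iff)
    with \<open>a \<noteq> b\<close> show "(\<Sum>p\<in>{p \<in> R. ?h p = e}. 1) = (2::nat)" by simp
  qed
  finally show ?thesis by simp
qed

lemma sum_category_size:
  assumes "finite S" "finite Cs" "f \<in> S \<rightarrow> Cs"
  shows "(\<Sum>c\<in>Cs. category_size S f c) = card S"
  using sum.group[OF assms(1,2), of f "\<lambda>_. 1::nat"] assms(3)
  by (auto simp: category_size_def)

text \<open>The square \<open>S \<times> S\<close> splits into ordered separated pairs, two for each
  unordered one, and pairs of equal category, which form disjoint squares, one per category.\<close>

lemma card_separated_pairs:
  assumes "finite S" "finite Cs" "f \<in> S \<rightarrow> Cs"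
  shows "2 * card (separated_pairs S f) + (\<Sum>c\<in>Cs. (category_size S f c)\<^sup>2) = (card S)\<^sup>2"
proof -
  let ?R = "{(s, s') \<in> S \<times> S. f s \<noteq> f s'}" and ?E = "{(s, s') \<in> S \<times> S. f s = f s'}"
  have fin: "finite ?R" "finite ?E"
    using assms(1) by (auto intro: finite_subset[of _ "S \<times> S"])
  have "separated_pairs S f = (\<lambda>(a, b). {a, b}) ` ?R"
    by (force simp: separated_pairs_def)
  moreover have "sym ?R" "irrefl ?R" by (auto simp: sym_def irrefl_def)
  ultimately have R: "2 * card (separated_pairs S f) = card ?R"
    using card_sym_irrefl[OF fin(1)] by simp
  have "?E = (\<Union>c\<in>Cs. {s \<in> S. f s = c} \<times> {s \<in> S. f s = c})"
    using assms(3) by auto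
  then have "card ?E = (\<Sum>c\<in>Cs. card ({s \<in> S. f s = c} \<times> {s \<in> S. f s = c}))"
    using assms(1,2) by (simp only:) (rule card_UN_disjoint, auto)
  then have E: "card ?E = (\<Sum>c\<in>Cs. (category_size S f c)\<^sup>2)"
    by (simp add: category_size_def card_cartesian_product power2_eq_square)
  have "card ?R + card ?E = card (?R \<union> ?E)"
    using fin by (intro card_Un_disjoint[symmetric]) auto
  also have "?R \<union> ?E = S \<times> S" by auto
  finally show ?thesis
    using R E by (simp add: card_cartesian_product power2_eq_square)
qed

text \<open>Substituting n - xk for y makes this a polynomial identity in n, x, k and the sum of
  squares. The subtracted sum measures how far f is from balanced.\<close>

lemma card_separated_pairs_excess:
  assumes "finite S" "finite Cs" "f \<in> S \<rightarrow> Cs" "card S = x * card Cs + y"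
  shows "2 * int (card (separated_pairs S f)) =
    int (card Cs) * int x * (int (card S) - int x) + int y * (int (card S) - 2 * int x - 1)
    - (\<Sum>c\<in>Cs. (int (category_size S f c) - int x) * (int (category_size S f c) - int x - 1))"
proof -
  let ?a = "\<lambda>c. int (category_size S f c)"
  have "(\<Sum>c\<in>Cs. (?a c - int x) * (?a c - int x - 1)) =
    (\<Sum>c\<in>Cs. (?a c)\<^sup>2 - (2 * int x + 1) * ?a c + int x * (int x + 1))"
    by (rule sum.cong) (simp_all add: algebra_simps power2_eq_square)
  also have "\<dots> = (\<Sum>c\<in>Cs. (?a c)\<^sup>2) - (2 * int x + 1) * (\<Sum>c\<in>Cs. ?a c)
    + int (card Cs) * (int x * (int x + 1))"
    by (simp add: sum.distrib sum_subtractf sum_distrib_left)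
  also have "(\<Sum>c\<in>Cs. ?a c) = int (card S)"
    using sum_category_size[OF assms(1-3)] by (metis of_nat_sum)
  finally have excess: "(\<Sum>c\<in>Cs. (?a c - int x) * (?a c - int x - 1)) =
    (\<Sum>c\<in>Cs. (?a c)\<^sup>2) - (2 * int x + 1) * int (card S)
    + int (card Cs) * (int x * (int x + 1))" .
  have "2 * int (card (separated_pairs S f)) + (\<Sum>c\<in>Cs. (?a c)\<^sup>2) = (int (card S))\<^sup>2"
    using arg_cong[OF card_separated_pairs[OF assms(1-3)], of int] by simp
  moreover have y: "int y = int (card S) - int x * int (card Cs)"
    using assms(4) by simp
  ultimately show ?thesis
    unfolding excess y by (simp add: algebra_simps power2_eq_square)
qed

lemma card_separated_pairs_le:
  assumes "finite S" "finite Cs" "f \<in> S \<rightarrow> Cs" "card S = x * card Cs + y"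
  shows "2 * int (card (separated_pairs S f)) \<le>
    int (card Cs) * int x * (int (card S) - int x) + int y * (int (card S) - 2 * int x - 1)"
proof -
  \<comment> \<open>Integrality matters: a > x forces a - x - 1 \<ge> 0, so the two factors never
    have opposite signs.\<close>
  have "0 \<le> (a - int x) * (a - int x - 1)" for a
    by (cases "a \<le> int x") (auto intro: mult_nonneg_nonneg mult_nonpos_nonpos)
  then show ?thesis
    using card_separated_pairs_excess[OF assms]
    by (simp add: sum_nonneg)
qed

lemma card_separated_pairs_balanced:
  assumes "finite S" "finite Cs" "f \<in> S \<rightarrow> Cs" "card S = x * card Cs + y"
    and "\<And>c. c \<in> Cs \<Longrightarrow> category_size S f c \<in> {x, x + 1}"
  shows "2 * int (card (separated_pairs S f)) =
    int (card Cs) * int x * (int (card S) - int x) + int y * (int (card S) - 2 * int x - 1)"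
proof -
  have "(\<Sum>c\<in>Cs. (int (category_size S f c) - int x) * (int (category_size S f c) - int x - 1)) = 0"
    using assms(5) by (intro sum.neutral) fastforce
  then show ?thesis
    using card_separated_pairs_excess[OF assms(1-4)] by simp
qed

section \<open>Layouts with few crossings\<close>

text \<open>The lexicographic order: category first, then \<open>r\<close>. Tied subjects keep their
  \<open>r\<close>-order, which is what prevents them from crossing.\<close>

definition refine_order :: "'s set \<Rightarrow> 'c rel \<Rightarrow> ('s \<Rightarrow> 'c) \<Rightarrow> 's rel \<Rightarrow> 's rel" where
  "refine_order S \<sigma> f r =
     {(s, s') \<in> S \<times> S. (f s, f s') \<in> \<sigma> - Id \<or> f s = f s' \<and> (s, s') \<in> r}"

lemma linear_order_on_refine_order:
  assumes \<sigma>: "linear_order_on Cs \<sigma>" and f: "f \<in> S \<rightarrow> Cs" and r: "linear_order_on S r"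
  shows "linear_order_on S (refine_order S \<sigma> f r)"
proof -
  have \<sigma>': "trans \<sigma>" "antisym \<sigma>" "total_on Cs \<sigma>"
    and r': "refl_on S r" "trans r" "antisym r" "total_on S r"
    using \<sigma> r by (auto simp: linear_order_on_def partial_order_on_def preorder_on_def)
  have "refl_on S (refine_order S \<sigma> f r)"
    using r'(1) by (auto simp: refl_on_def refine_order_def)
  moreover have "trans (refine_order S \<sigma> f r)"
  proof (rule transI)
    fix a b c assume "(a, b) \<in> refine_order S \<sigma> f r" "(b, c) \<in> refine_order S \<sigma> f r"
    then show "(a, c) \<in> refine_order S \<sigma> f r"
      unfolding refine_order_def using transD[OF \<sigma>'(1)] transD[OF r'(2)] antisymD[OF \<sigma>'(2)]
      by simp metis
  qed
  moreover have "antisym (refine_order S \<sigma> f r)"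
  proof (rule antisymI)
    fix a b assume "(a, b) \<in> refine_order S \<sigma> f r" "(b, a) \<in> refine_order S \<sigma> f r"
    then show "a = b"
      unfolding refine_order_def using antisymD[OF \<sigma>'(2)] antisymD[OF r'(3)]
      by simp metis
  qed
  moreover have "total_on S (refine_order S \<sigma> f r)"
  proof (rule total_onI)
    fix a b assume ab: "a \<in> S" "b \<in> S" "a \<noteq> b"
    then have "f a \<in> Cs" "f b \<in> Cs" using f by auto
    then show "(a, b) \<in> refine_order S \<sigma> f r \<or> (b, a) \<in> refine_order S \<sigma> f r"
      using ab \<sigma>'(3) r'(4) by (auto simp: refine_order_def total_on_def)
  qed
  moreover have "refine_order S \<sigma> f r \<subseteq> S \<times> S" by (auto simp: refine_order_def)
  ultimately show ?thesis
    by (simp add: linear_order_on_def partial_order_on_def preorder_on_def)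
qed

text \<open>The recursion runs from the last test backwards: \<open>lazy_layout S \<sigma> t m r i\<close> orders
  the subjects at test \<open>m - i\<close>.\<close>

primrec lazy_layout ::
  "'s set \<Rightarrow> 'c rel \<Rightarrow> (nat \<Rightarrow> 's \<Rightarrow> 'c) \<Rightarrow> nat \<Rightarrow> 's rel \<Rightarrow> nat \<Rightarrow> 's rel" where
  "lazy_layout S \<sigma> t m r 0 = refine_order S \<sigma> (t m) r"
| "lazy_layout S \<sigma> t m r (Suc i) = refine_order S \<sigma> (t (m - Suc i)) (lazy_layout S \<sigma> t m r i)"

text \<open>A pair tied at test j has the same order in \<open>\<pi> j\<close> and
  \<open>\<pi> (Suc j)\<close>, so the crossings of a step are charged to pairs separated by its
  earlier test. Hence \<open>D\<close> bounds only the tests before the last.\<close>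

lemma exists_layout_crossings_le:
  fixes D :: nat
  assumes "finite S" and \<sigma>: "linear_order_on Cs \<sigma>" and t: "\<And>j. j \<le> m \<Longrightarrow> t j \<in> S \<rightarrow> Cs"
    and D: "\<And>j. j < m \<Longrightarrow> card (separated_pairs S (t j)) \<le> D"
  shows "\<exists>\<pi>. combinatorial_layout m S t \<sigma> \<pi> \<and> crossings m S \<pi> \<le> m * D"
proof -
  \<comment> \<open>Any linear order may break the ties of the last test; a well-order supplies
    one.\<close>
  obtain r where r: "linear_order_on S r"
    using well_order_on[of S] by (auto simp: well_order_on_def)
  define \<pi> where "\<pi> j = lazy_layout S \<sigma> t m r (m - j)" for j
  have lin: "linear_order_on S (lazy_layout S \<sigma> t m r i)" if "i \<le> m" for i
    using that by (induction i) (simp_all add: linear_order_on_refine_order[OF \<sigma> t] r)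
  have \<pi>_Suc: "\<pi> j = refine_order S \<sigma> (t j) (\<pi> (Suc j))" if "j < m" for j
  proof -
    have "m - j = Suc (m - Suc j)" "m - Suc (m - Suc j) = j" using that by auto
    then show ?thesis by (simp add: \<pi>_def)
  qed
  have \<pi>_m: "\<pi> m = refine_order S \<sigma> (t m) r" by (simp add: \<pi>_def)
  have "combinatorial_layout m S t \<sigma> \<pi>"
    unfolding combinatorial_layout_def
  proof (intro allI impI conjI ballI)
    fix j assume "j \<le> m"
    show "linear_order_on S (\<pi> j)" unfolding \<pi>_def by (rule lin) simp
    obtain q where "\<pi> j = refine_order S \<sigma> (t j) q"
      using \<open>j \<le> m\<close> \<pi>_m \<pi>_Suc[of j] by (cases "j = m") auto
    then show "(s, s') \<in> \<pi> j - Id" if "s \<in> S" "s' \<in> S" "(t j s, t j s') \<in> \<sigma> - Id" for s s'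
      using that by (auto simp: refine_order_def)
  qed
  moreover have "crossings m S \<pi> \<le> m * D"
  proof -
    have "crossings m S \<pi> \<le> card (SIGMA j:{..<m}. separated_pairs S (t j))"
      unfolding crossings_def
    proof (rule card_mono)
      show "finite (SIGMA j:{..<m}. separated_pairs S (t j))"
        using finite_separated_pairs[OF assms(1)] by blast
      have "t j s \<noteq> t j s'"
        if "j < m" "s \<in> S" "s' \<in> S" "((s, s') \<in> \<pi> j) \<noteq> ((s, s') \<in> \<pi> (Suc j))" for j s s'
        using that \<pi>_Suc[of j] by (auto simp: refine_order_def)
      then show "{(j, {s, s'}) | j s s'. j < m \<and> s \<in> S \<and> s' \<in> S \<and> s \<noteq> s' \<and>
          ((s, s') \<in> \<pi> j) \<noteq> ((s, s') \<in> \<pi> (Suc j))}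
        \<subseteq> (SIGMA j:{..<m}. separated_pairs S (t j))"
        unfolding separated_pairs_def by blast
    qed
    also have "\<dots> = (\<Sum>j<m. card (separated_pairs S (t j)))"
      using finite_separated_pairs[OF assms(1)] by (intro card_SigmaI) auto
    also have "\<dots> \<le> (\<Sum>j<m. D)" using D by (intro sum_mono) auto
    finally show ?thesis by simp
  qed
  ultimately show ?thesis by blast
qed

section \<open>Bounds on the panel crossing number\<close>

lemma finite_crossing_set:
  "finite S \<Longrightarrow> finite {(j, {s, s'}) | j s s'. j < m \<and> s \<in> S \<and> s' \<in> S \<and> s \<noteq> s' \<and>
             ((s, s') \<in> \<pi> j) \<noteq> ((s, s') \<in> \<pi> (Suc j))}"
  by (rule finite_subset[of _ "{..<m} \<times> Pow S"]) auto

text \<open>There can be infinitely many layouts, since \<open>\<pi>\<close> is arbitrary beyond m,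
  but their crossing numbers are bounded. This gives \<open>Min\<close> in \<open>pcr\<close> its
  meaning.\<close>

lemma finite_crossings:
  assumes "finite S"
  shows "finite {crossings m S \<pi> | \<pi>. combinatorial_layout m S t \<sigma> \<pi>}"
proof (rule finite_subset[of _ "{..card ({..<m} \<times> Pow S)}"])
  have "crossings m S \<pi> \<le> card ({..<m} \<times> Pow S)" for \<pi>
    unfolding crossings_def using assms by (intro card_mono) auto
  then show "{crossings m S \<pi> | \<pi>. combinatorial_layout m S t \<sigma> \<pi>} \<subseteq> {..card ({..<m} \<times> Pow S)}"
    by blast
qed simp

lemma pcr_le:
  assumes "finite S" "linear_order_on Cs \<sigma>" "\<And>j. j \<le> m \<Longrightarrow> t j \<in> S \<rightarrow> Cs"
    and "\<And>j. j < m \<Longrightarrow> card (separated_pairs S (t j)) \<le> D"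
  shows "pcr m S t \<sigma> \<le> m * D"
proof -
  obtain \<pi> where "combinatorial_layout m S t \<sigma> \<pi>" "crossings m S \<pi> \<le> m * D"
    using exists_layout_crossings_le[of S Cs \<sigma> m t D, OF assms] by blast
  then show ?thesis
    unfolding pcr_def using finite_crossings[OF assms(1), of m t \<sigma>]
    by (blast intro: Min_le order_trans)
qed

text \<open>A layout must follow the strict category order at both tests of a step, so a pair whose
  categories are reversed there has no choice but to cross.\<close>

lemma crossings_reversing_ge:
  assumes "finite S" and lay: "combinatorial_layout m S t \<sigma> \<pi>"
    and rev: "\<And>j s s'. j < m \<Longrightarrow> s \<in> S \<Longrightarrow> s' \<in> S \<Longrightarrow> {s, s'} \<in> E \<Longrightarrow>
      (t j s, t j s') \<in> \<sigma> - Id \<and> (t (Suc j) s', t (Suc j) s) \<in> \<sigma> - Id \<or>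
      (t j s', t j s) \<in> \<sigma> - Id \<and> (t (Suc j) s, t (Suc j) s') \<in> \<sigma> - Id"
    and E: "E \<subseteq> {{s, s'} | s s'. s \<in> S \<and> s' \<in> S}"
  shows "m * card E \<le> crossings m S \<pi>"
proof -
  have "{..<m} \<times> E \<subseteq> {(j, {s, s'}) | j s s'. j < m \<and> s \<in> S \<and> s' \<in> S \<and> s \<noteq> s' \<and>
             ((s, s') \<in> \<pi> j) \<noteq> ((s, s') \<in> \<pi> (Suc j))}" (is "_ \<subseteq> ?X")
  proof (rule subrelI)
    fix j e assume "(j, e) \<in> {..<m} \<times> E"
    then have "j < m" "e \<in> E" by auto
    then obtain s s' where s: "s \<in> S" "s' \<in> S" "e = {s, s'}" using E by blast
    \<comment> \<open>\<open>crossings\<close> only compares membership of (s, s'), so antisymmetry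
      is used to exclude the opposite pair.\<close>
    have ord: "(a, b) \<in> \<pi> i \<and> (b, a) \<notin> \<pi> i \<and> a \<noteq> b"
      if "(t i a, t i b) \<in> \<sigma> - Id" "a \<in> S" "b \<in> S" "i \<le> m" for i a b
      using lay that unfolding combinatorial_layout_def linear_order_on_def partial_order_on_def
      by (blast dest: antisymD)
    have "j \<le> m" "Suc j \<le> m" using \<open>j < m\<close> by auto
    with rev[of j s s'] ord s \<open>e \<in> E\<close> \<open>j < m\<close>
    have "s \<noteq> s' \<and> ((s, s') \<in> \<pi> j) \<noteq> ((s, s') \<in> \<pi> (Suc j))"
      by blast
    then show "(j, e) \<in> ?X" using s \<open>j < m\<close> by blast
  qed
  then have "card ({..<m} \<times> E) \<le> card ?X"
    by (rule card_mono[OF finite_crossing_set[OF assms(1)]])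
  then show ?thesis by (simp add: crossings_def card_cartesian_product)
qed

lemma pcr_reversing_ge:
  assumes "finite S" "linear_order_on Cs \<sigma>" "\<And>j. j \<le> m \<Longrightarrow> t j \<in> S \<rightarrow> Cs"
    and "\<And>j s s'. j < m \<Longrightarrow> s \<in> S \<Longrightarrow> s' \<in> S \<Longrightarrow> {s, s'} \<in> E \<Longrightarrow>
      (t j s, t j s') \<in> \<sigma> - Id \<and> (t (Suc j) s', t (Suc j) s) \<in> \<sigma> - Id \<or>
      (t j s', t j s) \<in> \<sigma> - Id \<and> (t (Suc j) s, t (Suc j) s') \<in> \<sigma> - Id"
    and "E \<subseteq> {{s, s'} | s s'. s \<in> S \<and> s' \<in> S}"
  shows "m * card E \<le> pcr m S t \<sigma>"
proof -
  let ?X = "{crossings m S \<pi> | \<pi>. combinatorial_layout m S t \<sigma> \<pi>}"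
  \<comment> \<open>The size of \<open>D\<close> is irrelevant: it only serves to obtain some
    layout, so that the minimum is over a nonempty set.\<close>
  obtain D where "\<And>j. j < m \<Longrightarrow> card (separated_pairs S (t j)) \<le> D"
    using finite_imageI[of "{..<m}" "\<lambda>j. card (separated_pairs S (t j))"]
    by (metis finite_lessThan finite_nat_set_iff_bounded_le image_eqI lessThan_iff)
  then obtain \<pi> where "combinatorial_layout m S t \<sigma> \<pi>"
    using exists_layout_crossings_le[of S Cs \<sigma> m t, OF assms(1-3)] by blast
  then have "?X \<noteq> {}" by blast
  then show ?thesis
    unfolding pcr_def using finite_crossings[OF assms(1), of m t \<sigma>]
      crossings_reversing_ge[of S m t \<sigma> _ E, OF assms(1) _ assms(4,5)]
    by (subst Min_ge_iff) auto
qed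

section \<open>Balanced tests\<close>

text \<open>Writing p = qk + r, all q < x are admissible, and q = x is admissible exactly when r <
  y.\<close>

lemma card_mod_class:
  fixes x y k r :: nat
  assumes "y < k" "r < k"
  shows "card {p. p < x * k + y \<and> p mod k = r} = (if r < y then x + 1 else x)"
proof -
  let ?N = "if r < y then x + 1 else x"
  have "{p. p < x * k + y \<and> p mod k = r} = (\<lambda>q. q * k + r) ` {..<?N}"
  proof (intro equalityI subsetI)
    fix p assume "p \<in> {p. p < x * k + y \<and> p mod k = r}"
    then obtain q where p: "p < x * k + y" "p = q * k + r"
      using div_mult_mod_eq[of p k] by (metis (mono_tags, lifting) mem_Collect_eq)
    have "q < ?N"
    proof (rule ccontr)
      assume "\<not> q < ?N"
      then have "?N * k \<le> q * k" by (intro mult_right_mono) auto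
      then have "x * k + (if r < y then k else 0) \<le> q * k"
        by (cases "r < y") simp_all
      then show False using p assms by (cases "r < y", simp_all only: if_True if_False)
    qed
    then show "p \<in> (\<lambda>q. q * k + r) ` {..<?N}" using p(2) by blast
  next
    fix p assume "p \<in> (\<lambda>q. q * k + r) ` {..<?N}"
    then obtain q where q: "q < ?N" "p = q * k + r" by auto
    have "q * k + r < x * k + y"
    proof (cases "q < x")
      case True
      then have "Suc q * k \<le> x * k" by (intro mult_right_mono) auto
      then show ?thesis using assms by simp
    next
      case False
      then have "q = x" "r < y" using q(1) by (auto split: if_splits)
      then show ?thesis by simp
    qed
    then show "p \<in> {p. p < x * k + y \<and> p mod k = r}" using q assms by simp
  qed
  moreover have "inj_on (\<lambda>q. q * k + r) {..<?N}" using assms by (auto simp: inj_on_def)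
  ultimately show ?thesis by (simp add: card_image)
qed

text \<open>Subjects are numbered from 0 and dealt to the categories in rotation; the first y
  categories receive one more.\<close>

lemma balanced_index:
  fixes x y k :: nat
  assumes "finite S" "card S = x * k + y" "y < k"
  obtains f :: "'s \<Rightarrow> nat" where "f \<in> S \<rightarrow> {1..k}"
    and "\<And>i. i \<in> {1..k} \<Longrightarrow> card {s \<in> S. f s = i} = (if i \<le> y then x + 1 else x)"
proof -
  obtain h where h: "bij_betw h S {0..<card S}"
    using ex_bij_betw_finite_nat[OF assms(1)] by blast
  show thesis
  proof
    show "(\<lambda>s. Suc (h s mod k)) \<in> S \<rightarrow> {1..k}"
      using assms(3) by (auto simp: Suc_le_eq)
    fix i assume i: "i \<in> {1..k}"
    have "bij_betw h {s \<in> S. Suc (h s mod k) = i} {p. p < x * k + y \<and> p mod k = i - 1}"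
    proof (rule bij_betw_subset[OF h])
      have "h ` {s \<in> S. Suc (h s mod k) = i} = {p \<in> h ` S. Suc (p mod k) = i}" by blast
      also have "h ` S = {0..<x * k + y}" using h assms(2) by (simp add: bij_betw_def)
      also have "{p \<in> {0..<x * k + y}. Suc (p mod k) = i} = {p. p < x * k + y \<and> p mod k = i - 1}"
        using i by auto
      finally show "h ` {s \<in> S. Suc (h s mod k) = i} = {p. p < x * k + y \<and> p mod k = i - 1}" .
    qed auto
    then have "card {s \<in> S. Suc (h s mod k) = i} = card {p. p < x * k + y \<and> p mod k = i - 1}"
      by (rule bij_betw_same_card)
    then show "card {s \<in> S. Suc (h s mod k) = i} = (if i \<le> y then x + 1 else x)"
      using card_mod_class[OF assms(3), of "i - 1" x] i by auto
  qed
qed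

section \<open>The extremal value and a sequence of tests attaining it\<close>

theorem theorem4:
  fixes S :: "'s set" and Cs :: "'c set" and \<sigma> :: "'c rel" and C :: "nat \<Rightarrow> 'c"
    and n k m x y :: nat
  assumes "finite S" and "card S = n"
    and "bij_betw C {1..k} Cs"
    and "linear_order_on Cs \<sigma>"
    and "\<And>i j. i \<in> {1..k} \<Longrightarrow> j \<in> {1..k} \<Longrightarrow> i < j \<Longrightarrow> (C i, C j) \<in> \<sigma> - Id"
    and "m \<ge> 1"
    and "n = x * k + y" and "y < k"
  shows "real (ecr m S (test_sequences m S Cs) \<sigma>) =
           real m / 2 * (real k * real x * (real n - real x) +
                         real y * (real n - 2 * real x - 1)) \<and>
         (\<exists>t \<in> test_sequences m S Cs.
            pcr m S t \<sigma> = ecr m S (test_sequences m S Cs) \<sigma> \<and>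
            (\<forall>j\<le>m. card {i \<in> {1..k}. category_size S (t j) (C i) = x} = k - y \<and>
                    card {i \<in> {1..k}. category_size S (t j) (C i) = x + 1} = y) \<and>
            (\<forall>i\<in>{1..k}. \<forall>j<m.
               category_size S (t j) (C i) = category_size S (t (j + 1)) (C (k - i + 1))))"
proof -
  note C = assms(3) and \<sigma> = assms(4) and incr = assms(5)
  have finC: "finite Cs" and cardC: "card Cs = k"
    using bij_betw_finite[OF C] bij_betw_same_card[OF C] by simp_all
  have injC: "C i = C j \<longleftrightarrow> i = j" if "i \<in> {1..k}" "j \<in> {1..k}" for i j
    using C that by (auto simp: bij_betw_def dest: inj_onD)
  have CCs: "C i \<in> Cs" if "i \<in> {1..k}" for i using C that by (auto simp: bij_betw_def)
  obtain f where f: "f \<in> S \<rightarrow> {1..k}"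
    and fsize: "\<And>i. i \<in> {1..k} \<Longrightarrow> card {s \<in> S. f s = i} = (if i \<le> y then x + 1 else x)"
    using balanced_index[OF assms(1), of x k y] assms(2,7,8) by metis
  \<comment> \<open>\<open>g j\<close> is the identity at even j and the reversal of {1..k} at odd
    j. It is an involution, and consecutive ones differ by a reversal.\<close>
  define g where "g j i = (if even j then i else k - i + 1)" for j i :: nat
  have g: "g j i \<in> {1..k}" "g j (g j i) = i" "g (Suc j) i = g j (k - i + 1)"
    "g (Suc j) i = k - g j i + 1" if "i \<in> {1..k}" for i j
    using that by (auto simp: g_def)
  define t where "t = (\<lambda>j\<in>{0..m}. \<lambda>s\<in>S. C (g j (f s)))"
  have tT: "t \<in> test_sequences m S Cs"
    unfolding t_def test_sequences_def using f g(1) CCs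
    by (intro restrict_PiE_iff[THEN iffD2] ballI) blast
  have t: "t j s = C (g j (f s))" if "j \<le> m" "s \<in> S" for j s
    using that by (simp add: t_def)
  have tCs: "u j \<in> S \<rightarrow> Cs" if "u \<in> test_sequences m S Cs" "j \<le> m" for u j
    using PiE_mem[of u "{0..m}" "\<lambda>_. S \<rightarrow>\<^sub>E Cs" j] that
    by (simp add: test_sequences_def PiE_def)
  have fk: "f s \<in> {1..k}" if "s \<in> S" for s using f that by auto
  have size: "category_size S (t j) (C i) = (if g j i \<le> y then x + 1 else x)"
    if "i \<in> {1..k}" "j \<le> m" for i j
  proof -
    \<comment> \<open>Since C is injective on indices, the claim is \<open>g j (f s) = i\<close>;
      applying the involution \<open>g j\<close> to both sides moves it across.\<close>
    have "t j s = C i \<longleftrightarrow> f s = g j i" if "s \<in> S" for s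
      using t[OF \<open>j \<le> m\<close> that] injC[OF g(1)[OF fk[OF that]] \<open>i \<in> {1..k}\<close>]
        g(2)[OF fk[OF that]] g(2)[OF \<open>i \<in> {1..k}\<close>] by metis
    then have "{s \<in> S. t j s = C i} = {s \<in> S. f s = g j i}" by blast
    then show ?thesis using fsize[OF g(1)[OF that(1)]] by (simp add: category_size_def)
  qed
  \<comment> \<open>Because each \<open>g j\<close> is injective on {1..k}, every test up to m
    separates the same pairs, so test 0 represents them all.\<close>
  define E where "E = separated_pairs S (t 0)"
  have E: "{s, s'} \<in> E \<longleftrightarrow> f s \<noteq> f s'" if "s \<in> S" "s' \<in> S" for s s'
  proof -
    have "t 0 a = t 0 b \<longleftrightarrow> f a = f b" if "a \<in> S" "b \<in> S" for a b
      using that t[of 0] injC[OF fk fk] by (simp add: g_def)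
    then show ?thesis
      using that unfolding E_def separated_pairs_def mem_Collect_eq doubleton_eq_iff by metis
  qed
  have n: "card S = x * card Cs + y" using assms(2,7) cardC by simp
  have "category_size S (t 0) c \<in> {x, x + 1}" if "c \<in> Cs" for c
    using that C size[of _ 0] by (auto simp: bij_betw_def)
  then have cardE: "2 * int (card E) =
      int k * int x * (int n - int x) + int y * (int n - 2 * int x - 1)"
    using card_separated_pairs_balanced[OF assms(1) finC tCs[OF tT] n, of 0]
    by (simp add: E_def cardC assms(2))
  have upper: "pcr m S u \<sigma> \<le> m * card E" if "u \<in> test_sequences m S Cs" for u
  proof (rule pcr_le[OF assms(1) \<sigma> tCs[OF that]])
    fix j assume "j < m"
    then show "card (separated_pairs S (u j)) \<le> card E"
      using card_separated_pairs_le[OF assms(1) finC tCs[OF that] n, of j] cardE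
      by (simp add: cardC assms(2))
  qed
  have "m * card E \<le> pcr m S t \<sigma>"
  proof (rule pcr_reversing_ge[OF assms(1) \<sigma> tCs[OF tT]])
    show "E \<subseteq> {{s, s'} | s s'. s \<in> S \<and> s' \<in> S}"
      by (auto simp: E_def separated_pairs_def)
    fix j s s' assume *: "j < m" "s \<in> S" "s' \<in> S" "{s, s'} \<in> E"
    \<comment> \<open>The next test sends indices a and b to k - a + 1 and k - b + 1, so the
      category order of every pair in \<open>E\<close> flips.\<close>
    let ?a = "g j (f s)" and ?b = "g j (f s')"
    have ab: "?a \<in> {1..k}" "?b \<in> {1..k}" "?a \<noteq> ?b"
      using * E g(1) g(2) fk by metis+
    have tj: "t j s = C ?a" "t j s' = C ?b" "t (Suc j) s = C (k - ?a + 1)"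
      "t (Suc j) s' = C (k - ?b + 1)"
      using * t[of j] t[of "Suc j"] g(4)[OF fk] by auto
    show "(t j s, t j s') \<in> \<sigma> - Id \<and> (t (Suc j) s', t (Suc j) s) \<in> \<sigma> - Id \<or>
      (t j s', t j s) \<in> \<sigma> - Id \<and> (t (Suc j) s, t (Suc j) s') \<in> \<sigma> - Id"
    proof (cases "?a < ?b")
      case True
      then show ?thesis
        unfolding tj using ab by (intro disjI1 conjI incr) auto
    next
      case False
      then show ?thesis
        unfolding tj using ab by (intro disjI2 conjI incr) auto
    qed
  qed
  with upper[OF tT] have pcr_t: "pcr m S t \<sigma> = m * card E" by simp
  have ecr: "ecr m S (test_sequences m S Cs) \<sigma> = m * card E"
    unfolding ecr_def
  proof (rule Max_eqI)
    show "finite {pcr m S u \<sigma> | u. u \<in> test_sequences m S Cs}"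
      by (rule finite_subset[of _ "{..m * card E}"]) (auto dest: upper)
    show "m * card E \<in> {pcr m S u \<sigma> | u. u \<in> test_sequences m S Cs}"
      using pcr_t tT by (metis (mono_tags, lifting) mem_Collect_eq)
  qed (use upper in auto)
  have "2 * real (card E) =
      real k * real x * (real n - real x) + real y * (real n - 2 * real x - 1)"
    using arg_cong[OF cardE, of real_of_int] by simp
  then have formula: "real (ecr m S (test_sequences m S Cs) \<sigma>) = real m / 2 *
      (real k * real x * (real n - real x) + real y * (real n - 2 * real x - 1))"
    unfolding ecr by (simp flip: \<open>2 * real (card E) = _\<close>)
  have classes: "card {i \<in> {1..k}. category_size S (t j) (C i) = x} = k - y"
    "card {i \<in> {1..k}. category_size S (t j) (C i) = x + 1} = y" if "j \<le> m" for j
  proof -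
    \<comment> \<open>\<open>g j\<close> is its own inverse, so it maps the indices with
      \<open>P (g j i)\<close> bijectively onto those with \<open>P i\<close>.\<close>
    have card_g: "card {i \<in> {1..k}. P (g j i)} = card {i \<in> {1..k}. P i}" for P
      by (rule bij_betw_same_card[of "g j"], rule bij_betwI[where g = "g j"];
          (rule Pi_I)?; simp only: mem_Collect_eq g simp_thms)
    have "{i \<in> {1..k}. category_size S (t j) (C i) = x} = {i \<in> {1..k}. \<not> g j i \<le> y}"
      "{i \<in> {1..k}. category_size S (t j) (C i) = x + 1} = {i \<in> {1..k}. g j i \<le> y}"
      by (intro Collect_cong conj_cong refl; simp add: size[OF _ that])+
    moreover have "{i \<in> {1..k}. \<not> i \<le> y} = {y<..k}" "{i \<in> {1..k}. i \<le> y} = {1..y}"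
      using assms(8) by auto
    ultimately show "card {i \<in> {1..k}. category_size S (t j) (C i) = x} = k - y"
      "card {i \<in> {1..k}. category_size S (t j) (C i) = x + 1} = y"
      by (simp_all only: card_g[of "\<lambda>i. \<not> i \<le> y"] card_g[of "\<lambda>i. i \<le> y"])
        simp_all
  qed
  have mirror: "category_size S (t j) (C i) = category_size S (t (j + 1)) (C (k - i + 1))"
    if "i \<in> {1..k}" "j < m" for i j
  proof -
    \<comment> \<open>Mirroring twice returns i, so \<open>g(3)\<close> at the mirrored index
      relates test j + 1 there to test j at i.\<close>
    have i': "k - i + 1 \<in> {1..k}" "k - (k - i + 1) + 1 = i" using that by auto
    then have "g (Suc j) (k - i + 1) = g j i" using g(3)[OF i'(1), of j] by simp
    then show ?thesis using size[OF that(1)] size[OF i'(1)] that(2) by simp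
  qed
  show ?thesis
    by (intro conjI formula bexI[of _ t] tT allI impI ballI classes mirror)
      (simp_all only: pcr_t ecr)
qed

end
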